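(* There exists a weak solution of the stochastic difference equation $$X_n=X_{n-1}\xi_n,\quad n\in\mathbb{Z}_{\leq 0},$$ consisting of a filtered probability space $(\Omega,\mathcal{G},\mathbb{P},\mathcal{F})$ with $\mathcal{F}=(\mathcal{F}_n)_{n\in\mathbb{Z}_{\leq 0}}$ and a pair $(\xi,X)$ of processes on it, in which, for each $n\in\mathbb{Z}_{\leq 0}$, $X_n$ is a function of $\xi\vert_{\mathbb{Z}_{\leq n}}=(\xi_m)_{m\in\mathbb{Z}_{\leq n}}$, i.e. there is a map $f_n:\{-1,1\}^{\mathbb{Z}_{\leq n}}\to\{-1,1\}$ with $X_n(\omega)=f_n\big((\xi_m(\omega))_{m\in\mathbb{Z}_{\leq n}}\big)$ for all $\omega\in\Omega$. (Necessarily, such a function $f_n$ is not measurable with respect to the product $\sigma$-field $(2^{\{-1,1\}})^{\otimes\mathbb{Z}_{\leq n}}$.)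
   Context: All filtrations and processes are indexed by $\mathbb{Z}_{\leq 0}=\{\ldots,-2,-1,0\}$, and $\mathbb{Z}_{\leq n}=\{m\in\mathbb{Z}:m\leq n\}$. An equiprobable random sign is a $\{-1,1\}$-valued random variable taking the value $1$ with probability $\frac12$. A weak solution to the equation $X_n=X_{n-1}\xi_n$, $n\in\mathbb{Z}_{\leq 0}$, consists of a filtered probability space $(\Omega,\mathcal{G},\mathbb{P},\mathcal{F})$ (with $\mathcal{F}=(\mathcal{F}_n)_{n\in\mathbb{Z}_{\leq 0}}$ a nondecreasing family of sub-$\sigma$-fields of $\mathcal{G}$) and of a pair $(\xi,X)$ of $\mathcal{F}$-adapted $\{-1,1\}$-valued processes defined on it such that the equation holds (with $n$ running over all of $\mathbb{Z}_{\leq 0}$ and pointwise on $\Omega$) and such that for each $i\in\mathbb{Z}_{\leq 0}$, $\xi_i$ is an equiprobable random sign independent of $\mathcal{F}_{i-1}$. *)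

theory Defs
  imports "HOL-Probability.Probability"
begin

(* The index set of the nonpositive integers is the set of n :: int with n \<le> 0: families
   indexed by it are functions on int, and no condition involves their values at n > 0. *)

locale filtered_prob_space = prob_space M
  for M :: "'a measure" +
  fixes F :: "int \<Rightarrow> 'a measure"
  assumes subalgebra_F: "n \<le> 0 \<Longrightarrow> subalgebra M (F n)"
    and sets_F_mono: "m \<le> n \<Longrightarrow> n \<le> 0 \<Longrightarrow> sets (F m) \<subseteq> sets (F n)"

context prob_space
begin

definition equiprobable_sign :: "('a \<Rightarrow> int) \<Rightarrow> bool" where
  "equiprobable_sign Y \<longleftrightarrow>
     random_variable (count_space {-1, 1}) Y \<and> prob {\<omega> \<in> space M. Y \<omega> = 1} = 1 / 2"

end

(* Measurability into count_space {-1, 1} also says that the variable takes its values in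
   {-1, 1} everywhere on the sample space. The sets of the vimage_algebra below form the
   sigma-field generated by \<xi> n. *)
locale weak_solution = filtered_prob_space M F
  for M :: "'a measure" and F :: "int \<Rightarrow> 'a measure" +
  fixes \<xi> X :: "int \<Rightarrow> 'a \<Rightarrow> int"
  assumes adapted_\<xi>: "n \<le> 0 \<Longrightarrow> \<xi> n \<in> measurable (F n) (count_space {-1, 1})"
    and adapted_X: "n \<le> 0 \<Longrightarrow> X n \<in> measurable (F n) (count_space {-1, 1})"
    and equation: "n \<le> 0 \<Longrightarrow> \<omega> \<in> space M \<Longrightarrow> X n \<omega> = X (n - 1) \<omega> * \<xi> n \<omega>"
    and equiprobable_\<xi>: "n \<le> 0 \<Longrightarrow> equiprobable_sign (\<xi> n)"
    and indep_\<xi>: "n \<le> 0 \<Longrightarrow>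
      indep_set (sets (vimage_algebra (space M) (\<xi> n) (count_space {-1, 1}))) (sets (F (n - 1)))"

(* f is a map from {-1, 1}-valued sequences indexed by {..n} (extensional functions) to {-1, 1}. *)
definition function_of_past ::
  "'a measure \<Rightarrow> (int \<Rightarrow> 'a \<Rightarrow> int) \<Rightarrow> int \<Rightarrow> ('a \<Rightarrow> int) \<Rightarrow> ((int \<Rightarrow> int) \<Rightarrow> int) \<Rightarrow> bool" where
  "function_of_past M \<xi> n Y f \<longleftrightarrow>
     f \<in> ({..n} \<rightarrow>\<^sub>E {-1, 1}) \<rightarrow> {-1, 1} \<and>
     (\<forall>\<omega> \<in> space M. Y \<omega> = f (restrict (\<lambda>m. \<xi> m \<omega>) {..n}))"

end

theory Submission imports Defs begin

text \<open>
  Take \<open>X\<close> to be an i.i.d. sequence of fair signs and put \<open>\<xi>\<^sub>n = X\<^sub>n X\<^sub>n\<^sub>-\<^sub>1\<close>.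
  Since \<open>X\<^sub>n\<close> is a fair sign independent of \<open>X\<^sub>m\<close>, \<open>m < n\<close>, so is
  \<open>\<xi>\<^sub>n\<close>, and this is a weak solution. The noise up to time \<open>n\<close> determines the path
  \<open>x = (X\<^sub>m)\<^sub>m\<^sub>\<le>\<^sub>n\<close> only up to a global sign. To recover the sign, the axiom of choice is
  used to select, from every pair consisting of a class of paths modulo finite modifications and the
  negative of that class, exactly one of the two (\<open>tail_selector_exists\<close>). On the set \<open>W\<close> of
  selected paths the sign is determined, because at most one of \<open>x\<close> and \<open>-x\<close> is the initial
  part of a path in \<open>W\<close> (\<open>tail_selector_sign_determined\<close>); that \<open>W\<close> is a union of
  classes makes this work for every \<open>n\<close> at the same time.

  The set \<open>W\<close> is not measurable, but it has full outer measure
  (\<open>tail_selector_full_outer_measure\<close>). A measurable set \<open>S\<close> that is disjoint from \<open>W\<close>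
  can be enlarged to be invariant under finite modifications, and then \<open>-S\<close> is a subset of
  \<open>W\<close>, hence disjoint from \<open>S\<close>. But \<open>S\<close> and \<open>-S\<close> have the same mass in every
  cylinder, so in every measurable set, so in \<open>S\<close>: the mass of \<open>S\<close> is zero. A set of full
  outer measure inherits the probability measure, by \<open>pullback_measure_exists\<close>, and the solution
  restricted to \<open>W\<close> is still a solution.

  In an arbitrary weak solution, \<open>X\<^sub>n\<close> is a fair sign independent of each finite stretch of the
  noise up to time \<open>n\<close> (\<open>prob_X_past_\<xi>_symmetric\<close>), hence independent of the sigma-field
  generated by the whole past of the noise. A measurable function of that past cannot equal it.
\<close>

section \<open>Paths of independent fair signs and their sign flips\<close>

definition fair_sign :: "int measure" where
  "fair_sign = uniform_count_measure {-1, 1}"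

text \<open>
  The canonical space of an i.i.d. sequence of fair signs. It carries the process \<open>X\<close>, not the
  noise; the noise is recovered as \<open>X\<^sub>n X\<^sub>n\<^sub>-\<^sub>1\<close>.
\<close>

definition sign_paths :: "(int \<Rightarrow> int) measure" where
  "sign_paths = PiM {..0} (\<lambda>_. fair_sign)"

text \<open>
  These involutions of the path space form a group under symmetric difference of \<open>K\<close>;
  \<open>flip UNIV\<close> is \<open>x \<mapsto> -x\<close>. The restriction to \<open>{..0}\<close> keeps the
  paths extensional.
\<close>

definition flip :: "int set \<Rightarrow> (int \<Rightarrow> int) \<Rightarrow> int \<Rightarrow> int" where
  "flip K x = (\<lambda>m\<in>{..0}. if m \<in> K then - x m else x m)"

lemma space_fair_sign: "space fair_sign = {-1, 1}"
  by (simp add: fair_sign_def space_uniform_count_measure)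

lemma sets_fair_sign: "sets fair_sign = Pow {-1, 1}"
  by (simp add: fair_sign_def sets_uniform_count_measure)

lemma sets_fair_sign_count_space [measurable_cong]:
  "sets fair_sign = sets (count_space {-1, 1})"
  by (simp add: sets_fair_sign)

lemma prob_space_fair_sign: "prob_space fair_sign"
  unfolding fair_sign_def by (rule prob_space_uniform_count_measure) auto

lemma emeasure_fair_sign_uminus:
  assumes "A \<subseteq> {-1, 1}"
  shows "emeasure fair_sign (uminus ` A) = emeasure fair_sign A"
proof -
  have "uminus ` A \<subseteq> {-1, 1}" using assms by auto
  then show ?thesis
    using assms by (simp add: fair_sign_def emeasure_uniform_count_measure card_image)
qed

interpretation sign_paths: product_prob_space "\<lambda>_. fair_sign" "{..0::int}"
proof -
  interpret prob_space fair_sign by (rule prob_space_fair_sign)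
  show "product_prob_space (\<lambda>_. fair_sign)" by unfold_locales
qed

lemma space_sign_paths: "space sign_paths = {..0} \<rightarrow>\<^sub>E {-1, 1}"
  by (simp add: sign_paths_def space_PiM space_fair_sign)

lemma prob_space_sign_paths: "prob_space sign_paths"
  unfolding sign_paths_def by (rule sign_paths.P.prob_space_axioms)

lemma sign_cases: "x \<in> space sign_paths \<Longrightarrow> m \<le> 0 \<Longrightarrow> x m = -1 \<or> x m = 1"
  by (auto simp: space_sign_paths)

lemma flip_space: "x \<in> space sign_paths \<Longrightarrow> flip K x \<in> space sign_paths"
  by (auto simp: space_sign_paths flip_def PiE_iff)

lemma flip_apply: "m \<le> 0 \<Longrightarrow> flip K x m = (if m \<in> K then - x m else x m)"
  by (simp add: flip_def)

lemma flip_flip: "flip K (flip L x) = flip (sym_diff K L) x"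
  by (auto simp: flip_def fun_eq_iff)

lemma flip_empty: "x \<in> space sign_paths \<Longrightarrow> flip {} x = x"
  by (auto simp: space_sign_paths flip_def fun_eq_iff PiE_iff extensional_def)

lemma flip_cancel: "x \<in> space sign_paths \<Longrightarrow> flip K (flip K x) = x"
  by (simp add: flip_flip flip_empty)

lemma measurable_sign_paths_component [measurable]:
  "m \<le> 0 \<Longrightarrow> (\<lambda>x. x m) \<in> measurable sign_paths (count_space {-1, 1})"
  unfolding sign_paths_def
  using measurable_component_singleton[of m "{..0}" "\<lambda>_. fair_sign"]
  by (simp cong: measurable_cong_sets add: sets_fair_sign_count_space)

lemma measurable_flip: "flip K \<in> measurable sign_paths sign_paths"
proof -
  have [measurable]: "uminus \<in> measurable fair_sign fair_sign"
    by (auto simp: measurable_def space_fair_sign sets_fair_sign)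
  show ?thesis
    unfolding flip_def sign_paths_def
    by (intro measurable_restrict) (auto intro: measurable_component_singleton)
qed

text \<open>
  The generators \<open>prod_emb\<close> of the product sigma-field, in the form in which flips act on them
  visibly.
\<close>

definition cylinder :: "int set \<Rightarrow> (int \<Rightarrow> int set) \<Rightarrow> (int \<Rightarrow> int) set" where
  "cylinder J A = {x \<in> space sign_paths. \<forall>j\<in>J. x j \<in> A j}"

lemma prod_emb_eq_cylinder:
  "J \<subseteq> {..0} \<Longrightarrow> prod_emb {..0} (\<lambda>_. fair_sign) J (Pi\<^sub>E J A) = cylinder J A"
  by (auto simp: cylinder_def prod_emb_def sign_paths_def space_PiM PiE_iff restrict_def extensional_def)

lemma emeasure_cylinder:
  assumes "finite J" "J \<subseteq> {..0}" "\<And>j. j \<in> J \<Longrightarrow> A j \<subseteq> {-1, 1}"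
  shows "emeasure sign_paths (cylinder J A) = (\<Prod>j\<in>J. emeasure fair_sign (A j))"
  using sign_paths.emeasure_PiM_emb[of J A] assms
  by (simp add: prod_emb_eq_cylinder sign_paths_def sets_fair_sign)

lemma flip_vimage_cylinder:
  assumes "J \<subseteq> {..0}"
  shows "flip K -` cylinder J A \<inter> space sign_paths =
    cylinder J (\<lambda>j. if j \<in> K then uminus ` A j else A j)"
proof -
  have "- t \<in> B \<longleftrightarrow> t \<in> uminus ` B" for t :: int and B
    by (metis add.inverse_inverse imageE imageI)
  then show ?thesis
    using assms by (auto simp: cylinder_def flip_space flip_apply subset_eq)
qed

lemma sets_cylinder:
  assumes "finite J" "J \<subseteq> {..0}" "\<And>j. j \<in> J \<Longrightarrow> A j \<subseteq> {-1, 1}"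
  shows "cylinder J A \<in> sets sign_paths"
  using assms
  by (subst prod_emb_eq_cylinder[symmetric])
     (auto simp: sign_paths_def sets_fair_sign intro!: measurable_prod_emb sets_PiM_I_finite)

lemma sign_paths_measure_eqI:
  assumes "finite_measure P" "sets P = sets sign_paths" "sets Q = sets sign_paths"
    and "\<And>J A. finite J \<Longrightarrow> J \<subseteq> {..0} \<Longrightarrow> (\<And>j. j \<in> J \<Longrightarrow> A j \<subseteq> {-1, 1}) \<Longrightarrow>
      emeasure P (cylinder J A) = emeasure Q (cylinder J A)"
  shows "P = Q"
  using assms
  by (intro measure_eqI_PiM_infinite[of P "{..0}" "\<lambda>_. fair_sign"])
     (auto simp: sign_paths_def sets_fair_sign prod_emb_eq_cylinder)

text \<open>
  A fair sign is symmetric and the coordinates are independent, so changing the sign of an arbitrary,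
  possibly infinite, set of coordinates preserves the law. Flips of cofinite sets give the full outer
  measure of tail selectors, flips of single coordinates the independence of the noise from the past.
\<close>

lemma distr_flip: "distr sign_paths sign_paths (flip K) = sign_paths"
proof (rule sign_paths_measure_eqI)
  interpret prob_space sign_paths by (rule prob_space_sign_paths)
  show "finite_measure (distr sign_paths sign_paths (flip K))"
    by (rule finite_measure_distr[OF measurable_flip])
  fix J :: "int set" and A :: "int \<Rightarrow> int set"
  assume *: "finite J" "J \<subseteq> {..0}" and A: "\<And>j. j \<in> J \<Longrightarrow> A j \<subseteq> {-1, 1}"
  have "emeasure (distr sign_paths sign_paths (flip K)) (cylinder J A) =
      emeasure sign_paths (cylinder J (\<lambda>j. if j \<in> K then uminus ` A j else A j))"
    using * A by (simp add: emeasure_distr measurable_flip sets_cylinder flip_vimage_cylinder)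
  also have "\<dots> = (\<Prod>j\<in>J. emeasure fair_sign (if j \<in> K then uminus ` A j else A j))"
    by (intro emeasure_cylinder *) (use A in \<open>auto simp: image_subset_iff subset_eq\<close>)
  also have "\<dots> = (\<Prod>j\<in>J. emeasure fair_sign (A j))"
    by (intro prod.cong) (auto simp: emeasure_fair_sign_uminus A)
  also have "\<dots> = emeasure sign_paths (cylinder J A)"
    by (rule emeasure_cylinder[symmetric]) (use * A in auto)
  finally show "emeasure (distr sign_paths sign_paths (flip K)) (cylinder J A) =
    emeasure sign_paths (cylinder J A)" .
qed auto

lemma emeasure_flip_vimage:
  assumes "A \<in> sets sign_paths"
  shows "emeasure sign_paths (flip K -` A \<inter> space sign_paths) = emeasure sign_paths A"
  using emeasure_distr[OF measurable_flip assms] by (simp add: distr_flip)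

section \<open>Tail selectors and their outer measure\<close>

text \<open>
  A zero-one law in disguise. On a cylinder over a finite set \<open>J\<close>, the maps \<open>flip UNIV\<close>
  and \<open>flip (- J)\<close> have the same effect on \<open>S\<close>, because \<open>S\<close> is invariant under
  \<open>flip J\<close>; but \<open>flip (- J)\<close> fixes the cylinder. Hence \<open>S\<close> and \<open>-S\<close> have the
  same mass inside every cylinder, therefore inside every measurable set, in particular inside
  \<open>S\<close>, which \<open>-S\<close> does not meet.
\<close>

lemma null_set_if_disjoint_from_negative:
  assumes S: "S \<in> sets sign_paths"
    and inv: "\<And>x K. x \<in> S \<Longrightarrow> finite K \<Longrightarrow> K \<subseteq> {..0} \<Longrightarrow> flip K x \<in> S"
    and neg: "\<And>x. x \<in> S \<Longrightarrow> flip UNIV x \<notin> S"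
  shows "emeasure sign_paths S = 0"
proof -
  let ?N = "sign_paths"
  define T where "T = flip UNIV -` S \<inter> space ?N"
  have T: "T \<in> sets ?N"
    unfolding T_def by (rule measurable_sets[OF measurable_flip S])
  have S_space: "x \<in> S \<Longrightarrow> x \<in> space ?N" for x
    using sets.sets_into_space[OF S] by auto
  interpret prob_space ?N by (rule prob_space_sign_paths)
  have "density ?N (indicator S) = density ?N (indicator T)"
  proof (rule sign_paths_measure_eqI)
    show "finite_measure (density ?N (indicator S))"
      by (rule finite_measureI) (simp add: emeasure_restricted S)
  next
    fix J :: "int set" and A :: "int \<Rightarrow> int set"
    assume *: "finite J" "J \<subseteq> {..0}" "\<And>j. j \<in> J \<Longrightarrow> A j \<subseteq> {-1, 1}"
    then have C: "cylinder J A \<in> sets ?N" by (rule sets_cylinder)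
    have inv_iff: "flip J y \<in> S \<longleftrightarrow> y \<in> S" if "y \<in> space ?N" for y
      using inv[OF _ *(1,2)] flip_cancel[OF that] by metis
    have "flip (- J) x \<in> S \<inter> cylinder J A \<longleftrightarrow> x \<in> T \<inter> cylinder J A" if x: "x \<in> space ?N" for x
    proof -
      have eq: "flip (- J) x = flip J (flip UNIV x)"
        by (auto simp: flip_def fun_eq_iff)
      have "flip (- J) x \<in> S \<longleftrightarrow> flip UNIV x \<in> S"
        unfolding eq by (rule inv_iff[OF flip_space[OF x]])
      moreover have "flip (- J) x \<in> cylinder J A \<longleftrightarrow> x \<in> cylinder J A"
        using x *(2) by (auto simp: cylinder_def flip_space flip_apply subset_eq)
      ultimately show ?thesis using x by (auto simp: T_def)
    qed
    then have "flip (- J) -` (S \<inter> cylinder J A) \<inter> space ?N = T \<inter> cylinder J A"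
      using sets.sets_into_space[OF T] by blast
    then have "emeasure ?N (S \<inter> cylinder J A) = emeasure ?N (T \<inter> cylinder J A)"
      using emeasure_flip_vimage[of "S \<inter> cylinder J A" "- J"] S C by simp
    then show "emeasure (density ?N (indicator S)) (cylinder J A) =
        emeasure (density ?N (indicator T)) (cylinder J A)"
      by (simp add: emeasure_restricted S T C)
  qed auto
  then have "emeasure ?N (S \<inter> S) = emeasure ?N (T \<inter> S)"
    using emeasure_restricted[OF S S] emeasure_restricted[OF T S] by simp
  moreover have "T \<inter> S = {}"
    using neg by (auto simp: T_def)
  ultimately show ?thesis by simp
qed

text \<open>
  A union of classes of tail equivalence (agreement outside finitely many indices) which, out of
  each class and its negative, contains exactly one.
\<close>

definition tail_selector :: "(int \<Rightarrow> int) set \<Rightarrow> bool" where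
  "tail_selector W \<longleftrightarrow> W \<subseteq> space sign_paths \<and>
     (\<forall>x\<in>W. \<forall>y\<in>space sign_paths. finite {m. m \<le> 0 \<and> x m \<noteq> y m} \<longrightarrow> y \<in> W) \<and>
     (\<forall>x\<in>space sign_paths. flip UNIV x \<in> W \<longleftrightarrow> x \<notin> W)"

text \<open>
  Choose a representative \<open>r x\<close> in each union of a tail class with its negative, and keep the
  paths that are tail equivalent to the chosen representative rather than to its negative. The two
  possibilities exclude each other because \<open>x\<close> and \<open>-x\<close> differ at infinitely many
  indices.
\<close>

lemma tail_selector_exists: "\<exists>W. tail_selector W"
proof -
  define tail where "tail x y \<longleftrightarrow> finite {m. m \<le> 0 \<and> x m \<noteq> (y m :: int)}"
    for x y :: "int \<Rightarrow> int"
  have refl: "tail x x" for x by (simp add: tail_def)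
  have sym: "tail x y \<Longrightarrow> tail y x" for x y by (simp add: tail_def eq_commute)
  have trans: "tail x y \<Longrightarrow> tail y z \<Longrightarrow> tail x z" for x y z
    unfolding tail_def by (erule (1) finite_subset[OF _ finite_UnI, rotated]) auto
  have neg: "tail (flip UNIV x) y \<longleftrightarrow> tail x (flip UNIV y)" for x y
    unfolding tail_def by (rule arg_cong[where f=finite]) (auto simp: flip_apply)
  have negneg: "tail (flip UNIV x) (flip UNIV y) \<longleftrightarrow> tail x y" for x y
    unfolding tail_def by (rule arg_cong[where f=finite]) (auto simp: flip_apply)
  define R where "R x y \<longleftrightarrow> tail x y \<or> tail (flip UNIV x) y" for x y
  define r where "r x = (SOME y. R x y)" for x
  have R_r: "R x (r x)" for x
    unfolding r_def by (rule someI[of _ x]) (simp add: R_def refl)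
  have R_tail: "R x = R y" if "tail x y" for x y
    using that trans sym negneg unfolding R_def fun_eq_iff by metis
  have R_neg: "R (flip UNIV x) = R x" for x
  proof -
    have "tail (flip UNIV (flip UNIV x)) y \<longleftrightarrow> tail x y" for y
      using neg negneg by metis
    then show ?thesis by (auto simp: R_def fun_eq_iff)
  qed
  define W where "W = {x \<in> space sign_paths. tail x (r x)}"
  have not_neg: "\<not> tail x (flip UNIV x)" if "x \<in> space sign_paths" for x
  proof -
    have "{m. m \<le> 0 \<and> x m \<noteq> flip UNIV x m} = {..0}"
      using sign_cases[OF that] by (fastforce simp: flip_apply)
    then show ?thesis by (simp add: tail_def infinite_Iic)
  qed
  have "tail_selector W"
    unfolding tail_selector_def
  proof (intro conjI ballI impI)
    fix x y assume "x \<in> W" "y \<in> space sign_paths" "finite {m. m \<le> 0 \<and> x m \<noteq> y m}"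
    moreover then have "tail y x" by (simp add: tail_def eq_commute)
    moreover then have "r y = r x" by (simp add: r_def R_tail)
    ultimately show "y \<in> W" using trans by (auto simp: W_def)
  next
    fix x assume x: "x \<in> space sign_paths"
    have r: "r (flip UNIV x) = r x" by (simp add: r_def R_neg)
    have "tail x (r x) \<or> tail (flip UNIV x) (r x)" using R_r[of x] by (simp add: R_def)
    moreover have "\<not> (tail x (r x) \<and> tail (flip UNIV x) (r x))"
      using not_neg[OF x] trans sym by blast
    ultimately show "flip UNIV x \<in> W \<longleftrightarrow> x \<notin> W"
      using x flip_space[OF x] by (auto simp: W_def r)
  qed (auto simp: W_def)
  then show ?thesis ..
qed

lemma tail_selector_flip:
  assumes W: "tail_selector W" and "finite K" and x: "x \<in> space sign_paths"
  shows "flip K x \<in> W \<longleftrightarrow> x \<in> W"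
proof -
  have "{m. m \<le> 0 \<and> x m \<noteq> flip K x m} \<subseteq> K" "{m. m \<le> 0 \<and> flip K x m \<noteq> x m} \<subseteq> K"
    by (auto simp: flip_apply split: if_splits)
  then have "finite {m. m \<le> 0 \<and> x m \<noteq> flip K x m}" "finite {m. m \<le> 0 \<and> flip K x m \<noteq> x m}"
    using \<open>finite K\<close> finite_subset by blast+
  then show ?thesis
    using W x flip_space[OF x] unfolding tail_selector_def by blast
qed

text \<open>
  A tail selector \<open>W\<close> is not measurable, but it is large: it meets every measurable set of
  positive probability. Indeed, the saturation \<open>S\<close> of \<open>C\<close> under the countably many finite
  flips is still measurable and disjoint from \<open>W\<close>, so its negative is contained in \<open>W\<close> and
  \<open>S\<close> is disjoint from its negative.
\<close>

lemma tail_selector_full_outer_measure: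
  assumes W: "tail_selector W" and C: "C \<in> sets sign_paths" and disj: "C \<inter> W = {}"
  shows "emeasure sign_paths C = 0"
proof -
  let ?N = "sign_paths"
  define \<K> where "\<K> = {K. finite K \<and> K \<subseteq> {..0::int}}"
  define S where "S = (\<Union>K\<in>\<K>. flip K -` C \<inter> space ?N)"
  have "countable \<K>"
    using countable_Collect_finite_subset[of "{..0::int}"] by (simp add: \<K>_def)
  then have S: "S \<in> sets ?N"
    unfolding S_def by (intro sets.countable_UN') (auto intro: measurable_sets[OF measurable_flip C])
  have off_W: "x \<notin> W" if "x \<in> S" for x
  proof -
    from that obtain K where K: "finite K" "flip K x \<in> C" "x \<in> space ?N"
      by (auto simp: S_def \<K>_def)
    then have "flip K x \<notin> W" using disj by auto
    then show ?thesis using tail_selector_flip[OF W K(1,3)] by simp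
  qed
  have "emeasure ?N S = 0"
  proof (rule null_set_if_disjoint_from_negative[OF S])
    fix x :: "int \<Rightarrow> int" and K :: "int set"
    assume "x \<in> S" and K: "finite K" "K \<subseteq> {..0}"
    then obtain L where L: "finite L" "L \<subseteq> {..0}" "flip L x \<in> C" and x: "x \<in> space ?N"
      by (auto simp: S_def \<K>_def)
    have "flip (sym_diff L K) (flip K x) = flip L x"
      by (auto simp: flip_def fun_eq_iff)
    moreover have "sym_diff L K \<in> \<K>" using K L by (auto simp: \<K>_def)
    ultimately have "\<exists>K'\<in>\<K>. flip K' (flip K x) \<in> C" using L(3) by metis
    then show "flip K x \<in> S" using flip_space[OF x] by (auto simp: S_def)
  next
    fix x assume x: "x \<in> S"
    then have "x \<in> space ?N" using sets.sets_into_space[OF S] by auto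
    then have "flip UNIV x \<in> W"
      using off_W[OF x] W by (auto simp: tail_selector_def)
    then show "flip UNIV x \<notin> S" using off_W by auto
  qed
  moreover have "C \<subseteq> S"
  proof
    fix x assume "x \<in> C"
    moreover then have "x \<in> space ?N" using sets.sets_into_space[OF C] by auto
    moreover have "{} \<in> \<K>" by (simp add: \<K>_def)
    ultimately show "x \<in> S" unfolding S_def by (force simp: flip_empty)
  qed
  ultimately show ?thesis using emeasure_mono[OF _ S] by (metis le_zero_eq)
qed

section \<open>Restricting a measure to a set of full outer measure\<close>

text \<open>
  The trace of a probability measure on a subset that need not be measurable: a measure can be
  pulled back along \<open>\<phi>\<close> as soon as every measurable set missed by the image of \<open>\<phi>\<close>
  is null. Two measurable sets with the same preimage then differ by null sets only, so the mass of
  a preimage is well defined.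
\<close>

lemma pullback_measure_exists:
  fixes N :: "'b measure" and \<phi> :: "'a \<Rightarrow> 'b"
  assumes \<phi>: "\<phi> \<in> \<Omega> \<rightarrow> space N"
    and full: "\<And>A. A \<in> sets N \<Longrightarrow> \<phi> -` A \<inter> \<Omega> = {} \<Longrightarrow> emeasure N A = 0"
  shows "\<exists>M. space M = \<Omega> \<and> sets M = sets (vimage_algebra \<Omega> \<phi> N) \<and>
    (\<forall>A\<in>sets N. emeasure M (\<phi> -` A \<inter> \<Omega>) = emeasure N A)"
proof -
  define pre where "pre A = \<phi> -` A \<inter> \<Omega>" for A
  define \<S> where "\<S> = sets (vimage_algebra \<Omega> \<phi> N)"
  have \<S>: "\<S> = pre ` sets N"
    unfolding \<S>_def pre_def sets_vimage_algebra2[OF \<phi>] by auto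
  have unique: "emeasure N A = emeasure N B"
    if A: "A \<in> sets N" and B: "B \<in> sets N" and eq: "pre A = pre B" for A B
  proof -
    have "emeasure N (A - B) = 0" "emeasure N (B - A) = 0"
      using A B eq by (intro full; auto simp: pre_def)+
    then have "A - B \<in> null_sets N" "B - A \<in> null_sets N"
      using A B by auto
    then have "emeasure N A = emeasure N (A \<union> (B - A))" "emeasure N B = emeasure N (B \<union> (A - B))"
      using A B by (simp_all only: emeasure_Un_null_set)
    then show ?thesis by (simp add: Un_commute)
  qed
  define \<mu> where "\<mu> B = emeasure N (SOME A. A \<in> sets N \<and> pre A = B)" for B
  have \<mu>: "\<mu> (pre A) = emeasure N A" if A: "A \<in> sets N" for A
  proof -
    have "(SOME A'. A' \<in> sets N \<and> pre A' = pre A) \<in> sets N \<and>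
        pre (SOME A'. A' \<in> sets N \<and> pre A' = pre A) = pre A"
      by (rule someI[of _ A]) (simp add: A)
    then show ?thesis unfolding \<mu>_def by (intro unique A) auto
  qed
  define M where "M = measure_of \<Omega> \<S> \<mu>"
  have \<S>_Pow: "\<S> \<subseteq> Pow \<Omega>" by (auto simp: \<S> pre_def)
  have sigma: "sigma_algebra \<Omega> \<S>"
    using sets.sigma_algebra_axioms[of "vimage_algebra \<Omega> \<phi> N"] by (simp add: \<S>_def)
  have "countably_additive \<S> \<mu>"
    unfolding countably_additive_def
  proof (intro allI impI)
    fix B :: "nat \<Rightarrow> 'a set"
    assume B: "range B \<subseteq> \<S>" and disj: "disjoint_family B"
    from B have "\<forall>i. \<exists>A. A \<in> sets N \<and> B i = pre A" by (auto simp: \<S>)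
    then obtain A where A: "\<And>i. A i \<in> sets N" "\<And>i. B i = pre (A i)" by metis
    \<comment> \<open>The sets \<open>A i\<close> may overlap outside the image of \<open>\<phi>\<close>; making them disjoint does not
    change their preimages.\<close>
    have dA: "range (disjointed A) \<subseteq> sets N"
      using A by (intro sets.range_disjointed_sets) auto
    have pre_disjointed: "pre (disjointed A i) = B i" for i
    proof -
      have "pre (disjointed A i) = B i - (\<Union>j<i. B j)"
        by (auto simp: disjointed_def pre_def A(2) lessThan_atLeast0)
      moreover have "B i \<inter> B j = {}" if "j < i" for j
        using disj that by (auto simp: disjoint_family_on_def)
      ultimately show ?thesis by blast
    qed
    have \<mu>B: "\<mu> (B i) = emeasure N (disjointed A i)" for i
      using \<mu>[of "disjointed A i"] dA by (simp add: pre_disjointed image_subset_iff)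
    have "\<mu> (\<Union>i. B i) = \<mu> (pre (\<Union>i. disjointed A i))"
      by (rule arg_cong[where f=\<mu>]) (use pre_disjointed in \<open>auto simp: pre_def\<close>)
    also have "\<dots> = emeasure N (\<Union>i. disjointed A i)"
      using dA by (intro \<mu>) auto
    also have "\<dots> = (\<Sum>i. emeasure N (disjointed A i))"
      by (intro suminf_emeasure[symmetric] dA disjoint_family_disjointed)
    finally show "(\<Sum>i. \<mu> (B i)) = \<mu> (\<Union>i. B i)" by (simp add: \<mu>B)
  qed
  moreover have "positive \<S> \<mu>"
    using \<mu>[of "{}"] by (simp add: positive_def pre_def)
  ultimately have "emeasure M B = \<mu> B" if "B \<in> \<S>" for B
    unfolding M_def by (intro emeasure_measure_of_sigma sigma that)
  then have "\<forall>A\<in>sets N. emeasure M (pre A) = emeasure N A"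
    by (simp add: \<S> \<mu>)
  moreover have "space M = \<Omega>" "sets M = \<S>"
    using \<S>_Pow sigma by (simp_all add: M_def sigma_algebra.sigma_sets_eq)
  ultimately show ?thesis unfolding pre_def \<S>_def by blast
qed

section \<open>The noise does not determine a solution measurably\<close>

context weak_solution
begin

lemma F_events: "n \<le> 0 \<Longrightarrow> A \<in> sets (F n) \<Longrightarrow> A \<in> events"
  using subalgebra_F[of n] by (auto simp: subalgebra_def)

lemma space_F: "n \<le> 0 \<Longrightarrow> space (F n) = space M"
  using subalgebra_F[of n] by (auto simp: subalgebra_def)

lemma X_sign: "n \<le> 0 \<Longrightarrow> \<omega> \<in> space M \<Longrightarrow> X n \<omega> \<in> {-1, 1}"
  using measurable_space[OF adapted_X[of n]] by (simp add: space_F)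

lemma \<xi>_sign: "n \<le> 0 \<Longrightarrow> \<omega> \<in> space M \<Longrightarrow> \<xi> n \<omega> \<in> {-1, 1}"
  using measurable_space[OF adapted_\<xi>[of n]] by (simp add: space_F)

lemma measurable_\<xi>: "n \<le> 0 \<Longrightarrow> \<xi> n \<in> measurable M (count_space {-1, 1})"
  using equiprobable_\<xi> by (simp add: equiprobable_sign_def)

lemma \<xi>_event:
  assumes "n \<le> 0" "A \<subseteq> {-1, 1}"
  shows "{\<omega> \<in> space M. \<xi> n \<omega> \<in> A} \<in> sets (F n)"
  using measurable_sets[OF adapted_\<xi>, of n A] assms
  by (simp add: space_F vimage_def Int_def conj_commute)

lemma X_event:
  assumes n: "n \<le> 0"
  shows "{\<omega> \<in> space M. X n \<omega> = a} \<in> sets (F n)"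
proof -
  have "X n -` ({a} \<inter> {-1, 1}) \<inter> space (F n) \<in> sets (F n)"
    using n by (intro measurable_sets[OF adapted_X]) auto
  also have "X n -` ({a} \<inter> {-1, 1}) \<inter> space (F n) = {\<omega> \<in> space M. X n \<omega> = a}"
    using X_sign[OF n] by (auto simp: space_F[OF n])
  finally show ?thesis .
qed

lemma prob_\<xi>:
  assumes n: "n \<le> 0" and s: "s \<in> {-1, 1}"
  shows "prob {\<omega> \<in> space M. \<xi> n \<omega> = s} = 1 / 2"
proof -
  have one: "prob {\<omega> \<in> space M. \<xi> n \<omega> = 1} = 1 / 2"
    using equiprobable_\<xi>[OF n] by (simp add: equiprobable_sign_def)
  have "{\<omega> \<in> space M. \<xi> n \<omega> = 1} \<in> events"
    using F_events[OF n \<xi>_event[OF n, of "{1}"]] by simp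
  from prob_compl[OF this] one
  have "prob (space M - {\<omega> \<in> space M. \<xi> n \<omega> = 1}) = 1 / 2" by simp
  also have "space M - {\<omega> \<in> space M. \<xi> n \<omega> = 1} = {\<omega> \<in> space M. \<xi> n \<omega> = -1}"
    using \<xi>_sign[OF n] by auto
  finally show ?thesis using one s by auto
qed

lemma prob_past_inter_\<xi>:
  assumes n: "n \<le> 0" and s: "s \<in> {-1, 1}" and D: "D \<in> sets (F (n - 1))"
  shows "prob (D \<inter> {\<omega> \<in> space M. \<xi> n \<omega> = s}) = prob D / 2"
proof -
  have "\<xi> n -` {s} \<inter> space M \<in> sets (vimage_algebra (space M) (\<xi> n) (count_space {-1, 1}))"
    using s by (intro in_vimage_algebra) auto
  from indep_setD[OF indep_\<xi>[OF n] this D]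
  have "prob ((\<xi> n -` {s} \<inter> space M) \<inter> D) = prob (\<xi> n -` {s} \<inter> space M) * prob D" .
  moreover have "\<xi> n -` {s} \<inter> space M = {\<omega> \<in> space M. \<xi> n \<omega> = s}" by auto
  ultimately show ?thesis by (simp add: prob_\<xi>[OF n s] Int_commute)
qed

text \<open>
  One step of the recursion, read backwards: \<open>X\<^sub>n = a\<close> together with \<open>\<xi>\<^sub>n = s\<close> means
  \<open>X\<^sub>n\<^sub>-\<^sub>1 = a s\<close> together with \<open>\<xi>\<^sub>n = s\<close>, and the second event is a fair
  coin toss independent of the past.
\<close>

lemma prob_step:
  assumes n: "n \<le> 0" and A: "A \<subseteq> {-1, 1}" and a: "a \<in> {-1, 1}" and D: "D \<in> sets (F (n - 1))"
  shows "prob (D \<inter> {\<omega> \<in> space M. X n \<omega> = a \<and> \<xi> n \<omega> \<in> A}) =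
    (\<Sum>s\<in>A. prob (D \<inter> {\<omega> \<in> space M. X (n - 1) \<omega> = a * s})) / 2"
proof -
  define E where "E s = D \<inter> {\<omega> \<in> space M. X (n - 1) \<omega> = a * s}" for s
  have E: "E s \<in> sets (F (n - 1))" for s
    unfolding E_def using n by (intro sets.Int D X_event) auto
  have E': "E s \<inter> {\<omega> \<in> space M. \<xi> n \<omega> = s} \<in> events" if "s \<in> A" for s
    using F_events[OF _ E] F_events[OF n \<xi>_event[OF n, of "{s}"]] n that A by auto
  have *: "X n \<omega> = a \<longleftrightarrow> X (n - 1) \<omega> = a * \<xi> n \<omega>" if "\<omega> \<in> space M" for \<omega>
    using equation[OF n that] \<xi>_sign[OF n that] X_sign[OF _ that, of "n - 1"] n a by auto
  have "D \<inter> {\<omega> \<in> space M. X n \<omega> = a \<and> \<xi> n \<omega> \<in> A} =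
      (\<Union>s\<in>A. E s \<inter> {\<omega> \<in> space M. \<xi> n \<omega> = s})"
    using * by (auto simp: E_def)
  also have "prob \<dots> = (\<Sum>s\<in>A. prob (E s \<inter> {\<omega> \<in> space M. \<xi> n \<omega> = s}))"
    using A E' by (intro finite_measure_finite_Union)
      (auto simp: disjoint_family_on_def intro: finite_subset)
  also have "\<dots> = (\<Sum>s\<in>A. prob (E s) / 2)"
    using A by (intro sum.cong refl prob_past_inter_\<xi> n E) auto
  finally show ?thesis by (simp add: E_def sum_divide_distrib)
qed

lemma past_\<xi>_event:
  assumes "n \<le> 0" and A: "\<And>i. A i \<subseteq> {-1, 1}"
  shows "{\<omega> \<in> space M. \<forall>i\<in>{k<..n}. \<xi> i \<omega> \<in> A i} \<in> sets (F n)"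
proof -
  have "{\<omega> \<in> space M. \<forall>i\<in>{k<..n}. \<xi> i \<omega> \<in> A i} =
      space (F n) \<inter> (\<Inter>i\<in>{k<..n}. {\<omega> \<in> space M. \<xi> i \<omega> \<in> A i})" (is "_ = _ \<inter> ?I")
    using assms by (auto simp: space_F)
  also have "\<dots> \<in> sets (F n)"
  proof (cases "{k<..n} = {}")
    case False
    have "{\<omega> \<in> space M. \<xi> i \<omega> \<in> A i} \<in> sets (F n)" if "i \<in> {k<..n}" for i
      using \<xi>_event[of i "A i"] sets_F_mono[of i n] assms that by auto
    then show ?thesis
      using False by (intro sets.Int sets.finite_INT) auto
  qed simp
  finally show ?thesis .
qed

text \<open>
  Given any finite stretch of the noise, both values of \<open>X\<^sub>n\<close> are equally likely. At the
  start of the stretch this is because \<open>X\<^sub>k = X\<^sub>k\<^sub>-\<^sub>1 \<xi>\<^sub>k\<close> with a fair sign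
  \<open>\<xi>\<^sub>k\<close> independent of \<open>X\<^sub>k\<^sub>-\<^sub>1\<close>; each further step permutes the two values
  of \<open>X\<close>, in a way that depends on the noise only.
\<close>

lemma prob_X_past_\<xi>_symmetric:
  assumes "k \<le> n" "n \<le> 0" and A: "\<And>i. A i \<subseteq> {-1, 1}"
  shows "prob {\<omega> \<in> space M. X n \<omega> = 1 \<and> (\<forall>i\<in>{k<..n}. \<xi> i \<omega> \<in> A i)} =
    prob {\<omega> \<in> space M. X n \<omega> = -1 \<and> (\<forall>i\<in>{k<..n}. \<xi> i \<omega> \<in> A i)}"
  using assms(1,2)
proof (induction n rule: int_ge_induct)
  case base
  have "prob {\<omega> \<in> space M. X k \<omega> = a} =
      (\<Sum>s\<in>{-1, 1}. prob {\<omega> \<in> space M. X (k - 1) \<omega> = a * s}) / 2" if "a \<in> {-1, 1}" for a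
  proof -
    have "space M \<inter> {\<omega> \<in> space M. X k \<omega> = a \<and> \<xi> k \<omega> \<in> {-1, 1}} = {\<omega> \<in> space M. X k \<omega> = a}"
      using \<xi>_sign[OF base] by auto
    moreover have "space M \<in> sets (F (k - 1))"
      using sets.top[of "F (k - 1)"] base by (simp add: space_F)
    moreover have "space M \<inter> {\<omega> \<in> space M. P \<omega>} = {\<omega> \<in> space M. P \<omega>}" for P by auto
    ultimately show ?thesis using prob_step[OF base subset_refl that, of "space M"] by simp
  qed
  from this[of 1] this[of "-1"] show ?case by simp
next
  case (step n)
  define D where "D = {\<omega> \<in> space M. \<forall>i\<in>{k<..n}. \<xi> i \<omega> \<in> A i}"
  have D: "D \<in> sets (F (n + 1 - 1))"
    unfolding D_def using past_\<xi>_event[of n A k] step.prems A by simp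
  have D_X: "D \<inter> {\<omega> \<in> space M. X n \<omega> = b} =
      {\<omega> \<in> space M. X n \<omega> = b \<and> (\<forall>i\<in>{k<..n}. \<xi> i \<omega> \<in> A i)}" for b
    by (auto simp: D_def)
  have IH: "prob (D \<inter> {\<omega> \<in> space M. X n \<omega> = -1}) = prob (D \<inter> {\<omega> \<in> space M. X n \<omega> = 1})"
    using step.IH step.prems unfolding D_X by simp
  have Suc: "{k<..n + 1} = insert (n + 1) {k<..n}" using step.hyps by auto
  have eq: "prob {\<omega> \<in> space M. X (n + 1) \<omega> = a \<and> (\<forall>i\<in>{k<..n + 1}. \<xi> i \<omega> \<in> A i)} =
      (\<Sum>s\<in>A (n + 1). prob (D \<inter> {\<omega> \<in> space M. X n \<omega> = a * s})) / 2" if "a \<in> {-1, 1}" for a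
  proof -
    have "{\<omega> \<in> space M. X (n + 1) \<omega> = a \<and> (\<forall>i\<in>{k<..n + 1}. \<xi> i \<omega> \<in> A i)} =
        D \<inter> {\<omega> \<in> space M. X (n + 1) \<omega> = a \<and> \<xi> (n + 1) \<omega> \<in> A (n + 1)}"
      unfolding Suc by (auto simp: D_def)
    then show ?thesis using prob_step[OF step.prems A that D] by simp
  qed
  have "prob (D \<inter> {\<omega> \<in> space M. X n \<omega> = 1 * s}) = prob (D \<inter> {\<omega> \<in> space M. X n \<omega> = -1 * s})"
    if "s \<in> A (n + 1)" for s
    using that A[of "n + 1"] IH by auto
  then show ?case using eq[of 1] eq[of "-1"] by (simp cong: sum.cong)
qed

text \<open>
  Cylinders constrain finitely many coordinates and generate the product sigma-field, so the symmetry
  passes from finite stretches of the noise to its whole past.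
\<close>

lemma past_laws_agree:
  assumes n: "n \<le> 0"
  defines "P \<equiv> PiM {..n} (\<lambda>_. count_space {-1, 1 :: int})"
    and "past \<equiv> \<lambda>\<omega>. restrict (\<lambda>m. \<xi> m \<omega>) {..n}"
  shows "distr (density M (indicator {\<omega> \<in> space M. X n \<omega> = 1})) P past =
    distr (density M (indicator {\<omega> \<in> space M. X n \<omega> = -1})) P past"
proof -
  have past: "past \<in> measurable M P"
    unfolding past_def P_def using n by (intro measurable_restrict measurable_\<xi>) auto
  have X: "{\<omega> \<in> space M. X n \<omega> = a} \<in> events" for a
    using F_events[OF n X_event[OF n]] .
  have law: "emeasure (distr (density M (indicator {\<omega> \<in> space M. X n \<omega> = a})) P past) E =
      emeasure M {\<omega> \<in> space M. X n \<omega> = a \<and> past \<omega> \<in> E}" if E: "E \<in> sets P" for a E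
  proof -
    have "past -` E \<inter> space M \<in> events" using measurable_sets[OF past E] .
    moreover have "{\<omega> \<in> space M. X n \<omega> = a} \<inter> (past -` E \<inter> space M) =
        {\<omega> \<in> space M. X n \<omega> = a \<and> past \<omega> \<in> E}" by auto
    ultimately show ?thesis
      using past E by (simp add: emeasure_distr emeasure_restricted X)
  qed
  show ?thesis
  proof (rule measure_eqI_PiM_infinite[of _ "{..n}" "\<lambda>_. count_space {-1, 1}"])
    fix A J assume J: "finite J" "J \<subseteq> {..n}"
      and A: "\<And>i. i \<in> J \<Longrightarrow> A i \<in> sets (count_space {-1, 1 :: int})"
    define C where "C = prod_emb {..n} (\<lambda>_. count_space {-1, 1 :: int}) J (Pi\<^sub>E J A)"
    have C: "C \<in> sets P"
      unfolding C_def P_def using J A by (intro measurable_prod_emb sets_PiM_I_finite) auto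
    \<comment> \<open>A stretch \<open>{k<..n}\<close> long enough to contain \<open>J\<close>, with vacuous constraints off \<open>J\<close>.\<close>
    define k where "k = Min (insert n J) - 1"
    have "Min (insert n J) \<le> n" using J by (intro Min_le) auto
    then have k: "k \<le> n" by (simp add: k_def)
    have "Min (insert n J) \<le> j" if "j \<in> J" for j using J that by (intro Min_le) auto
    then have J_k: "J \<subseteq> {k<..n}" using J(2) unfolding k_def by fastforce
    define B where "B i = (if i \<in> J then A i else {-1, 1})" for i
    have B: "B i \<subseteq> {-1, 1}" for i using A[of i] by (auto simp: B_def)
    have *: "past \<omega> \<in> C \<longleftrightarrow> (\<forall>i\<in>{k<..n}. \<xi> i \<omega> \<in> B i)" if \<omega>: "\<omega> \<in> space M" for \<omega>
    proof -
      have "past \<omega> \<in> C \<longleftrightarrow> (\<forall>i\<in>J. \<xi> i \<omega> \<in> A i)"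
        using measurable_space[OF past \<omega>] J
        by (auto simp: C_def past_def P_def space_PiM prod_emb_def PiE_iff subset_eq)
      also have "\<dots> \<longleftrightarrow> (\<forall>i\<in>{k<..n}. \<xi> i \<omega> \<in> B i)"
        using J_k \<xi>_sign[OF _ \<omega>] n by (auto simp: B_def)
      finally show ?thesis .
    qed
    have "{\<omega> \<in> space M. X n \<omega> = a \<and> past \<omega> \<in> C} =
        {\<omega> \<in> space M. X n \<omega> = a \<and> (\<forall>i\<in>{k<..n}. \<xi> i \<omega> \<in> B i)}" for a
      using * by auto
    then have "emeasure M {\<omega> \<in> space M. X n \<omega> = 1 \<and> past \<omega> \<in> C} =
        emeasure M {\<omega> \<in> space M. X n \<omega> = -1 \<and> past \<omega> \<in> C}"
      using prob_X_past_\<xi>_symmetric[OF k n B] by (simp add: emeasure_eq_measure)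
    then show "emeasure (distr (density M (indicator {\<omega> \<in> space M. X n \<omega> = 1})) P past)
          (prod_emb {..n} (\<lambda>_. count_space {-1, 1}) J (Pi\<^sub>E J A)) =
        emeasure (distr (density M (indicator {\<omega> \<in> space M. X n \<omega> = -1})) P past)
          (prod_emb {..n} (\<lambda>_. count_space {-1, 1}) J (Pi\<^sub>E J A))"
      using law[OF C] unfolding C_def by simp
  next
    show "finite_measure (distr (density M (indicator {\<omega> \<in> space M. X n \<omega> = 1})) P past)"
    proof (rule finite_measureI)
      show "emeasure (distr (density M (indicator {\<omega> \<in> space M. X n \<omega> = 1})) P past)
        (space (distr (density M (indicator {\<omega> \<in> space M. X n \<omega> = 1})) P past)) \<noteq> \<infinity>"
        using law[OF sets.top] by simp
    qed
  qed (simp_all add: P_def)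
qed

text \<open>
  For measurable \<open>f\<close>, the event \<open>X\<^sub>n = a\<close> would be an event about the past of the noise.
  By \<open>past_laws_agree\<close> its intersections with \<open>X\<^sub>n = a\<close> and with \<open>X\<^sub>n = -a\<close> would be equally
  likely; so it would be null, for both values of \<open>a\<close>.
\<close>

lemma function_of_past_not_measurable:
  assumes n: "n \<le> 0" and f: "function_of_past M \<xi> n (X n) f"
  shows "f \<notin> measurable (PiM {..n} (\<lambda>_. count_space {-1, 1})) (count_space {-1, 1})"
proof
  let ?P = "PiM {..n} (\<lambda>_. count_space {-1, 1 :: int})"
  let ?past = "\<lambda>\<omega>. restrict (\<lambda>m. \<xi> m \<omega>) {..n}"
  assume meas: "f \<in> measurable ?P (count_space {-1, 1})"
  have past: "?past \<in> measurable M ?P"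
    using n by (intro measurable_restrict measurable_\<xi>) auto
  have X_f: "X n \<omega> = f (?past \<omega>)" if "\<omega> \<in> space M" for \<omega>
    using f that by (auto simp: function_of_past_def)
  have X: "{\<omega> \<in> space M. X n \<omega> = a} \<in> events" for a
    using F_events[OF n X_event[OF n]] .
  have null: "prob {\<omega> \<in> space M. X n \<omega> = a} = 0" if a: "a \<in> {-1, 1}" for a
  proof -
    define E where "E = f -` {a} \<inter> space ?P"
    have E: "E \<in> sets ?P"
      unfolding E_def using a by (intro measurable_sets[OF meas]) auto
    have preE: "?past -` E \<inter> space M = {\<omega> \<in> space M. X n \<omega> = a}"
      using X_f measurable_space[OF past] by (auto simp: E_def)
    have law: "emeasure (distr (density M (indicator {\<omega> \<in> space M. X n \<omega> = b})) ?P ?past) E =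
        emeasure M ({\<omega> \<in> space M. X n \<omega> = b} \<inter> {\<omega> \<in> space M. X n \<omega> = a})" for b
      using past E X by (simp add: emeasure_distr preE emeasure_restricted)
    have "emeasure M ({\<omega> \<in> space M. X n \<omega> = a} \<inter> {\<omega> \<in> space M. X n \<omega> = a}) =
        emeasure M ({\<omega> \<in> space M. X n \<omega> = - a} \<inter> {\<omega> \<in> space M. X n \<omega> = a})"
      using past_laws_agree[OF n] law[of 1] law[of "-1"] a by auto
    also have "{\<omega> \<in> space M. X n \<omega> = - a} \<inter> {\<omega> \<in> space M. X n \<omega> = a} = {}"
      using a by auto
    finally show ?thesis by (simp add: measure_def)
  qed
  have "space M = {\<omega> \<in> space M. X n \<omega> = -1} \<union> {\<omega> \<in> space M. X n \<omega> = 1}"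
    using X_sign[OF n] by auto
  then have "prob (space M) \<le> prob {\<omega> \<in> space M. X n \<omega> = -1} + prob {\<omega> \<in> space M. X n \<omega> = 1}"
    using measure_Un_le[OF X[of "-1"] X[of 1]] by simp
  then show False using null[of 1] null[of "-1"] prob_space by simp
qed

end

section \<open>The solution carried by a tail selector\<close>

text \<open>
  Why the solution is a function of its noise. The noise \<open>x\<^sub>m x\<^sub>m\<^sub>-\<^sub>1\<close>, \<open>m \<le> n\<close>,
  determines the path up to \<open>n\<close> except for one global sign. The wrong sign would make
  \<open>y\<close> tail equivalent to \<open>-x\<close>, and \<open>W\<close> does not contain paths from both tail
  classes.
\<close>

lemma tail_selector_sign_determined:
  assumes W: "tail_selector W" and x: "x \<in> W" and y: "y \<in> W" and n: "n \<le> 0"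
    and eq: "\<And>m. m \<le> n \<Longrightarrow> x m * x (m - 1) = y m * y (m - 1)"
  shows "x n = y n"
proof (rule ccontr)
  assume "x n \<noteq> y n"
  have xs: "x \<in> space sign_paths" and ys: "y \<in> space sign_paths"
    using W x y by (auto simp: tail_selector_def)
  have opp: "y m = - x m" if "m \<le> n" for m
    using that
  proof (induction m rule: int_le_induct)
    case base
    show ?case
      using \<open>x n \<noteq> y n\<close> sign_cases[OF xs n] sign_cases[OF ys n] by auto
  next
    case (step m)
    then show ?case
      using eq[of m] sign_cases[OF xs, of m] sign_cases[OF ys, of m] n by auto
  qed
  have "{m. m \<le> 0 \<and> y m \<noteq> flip UNIV x m} \<subseteq> {n<..0}"
  proof
    fix m assume "m \<in> {m. m \<le> 0 \<and> y m \<noteq> flip UNIV x m}"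
    then show "m \<in> {n<..0}" using opp[of m] by (cases "m \<le> n") (auto simp: flip_apply)
  qed
  then have "finite {m. m \<le> 0 \<and> y m \<noteq> flip UNIV x m}"
    by (rule finite_subset) simp
  then have "flip UNIV x \<in> W"
    using W y flip_space[OF xs] unfolding tail_selector_def by blast
  then show False using W x xs by (auto simp: tail_selector_def)
qed

lemma increment_event:
  assumes "n \<le> 0"
  shows "{x \<in> space sign_paths. x n * x (n - 1) \<in> A} \<in> sets sign_paths"
proof -
  have [measurable]: "(\<lambda>x. x n) \<in> measurable sign_paths (count_space UNIV)"
      "(\<lambda>x. x (n - 1)) \<in> measurable sign_paths (count_space UNIV)"
    using assms by (auto intro: measurable_compose[OF measurable_sign_paths_component measurable_count_space])
  show ?thesis by measurable
qed

text \<open>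
  Flipping \<open>x\<^sub>n\<close> alone exchanges the two values of \<open>x\<^sub>n x\<^sub>n\<^sub>-\<^sub>1\<close> and preserves
  \<open>E\<close>. For \<open>E\<close> depending on the coordinates below \<open>n\<close> this gives the independence of
  the noise from the past, and for the whole space its fairness.
\<close>

lemma increment_conditional_law:
  assumes n: "n \<le> 0" and A: "A \<subseteq> {-1, 1}" and E: "E \<in> sets sign_paths"
    and inv: "\<And>x. x \<in> space sign_paths \<Longrightarrow> flip {n} x \<in> E \<longleftrightarrow> x \<in> E"
  shows "measure sign_paths ({x \<in> space sign_paths. x n * x (n - 1) \<in> A} \<inter> E) =
    real (card A) / 2 * measure sign_paths E"
proof -
  let ?N = "sign_paths"
  interpret prob_space ?N by (rule prob_space_sign_paths)
  define I where "I s = {x \<in> space ?N. x n * x (n - 1) = s}" for s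
  have I: "I s \<in> sets ?N" for s
    using increment_event[OF n, of "{s}"] by (simp add: I_def)
  have E_space: "E \<subseteq> space ?N" using sets.sets_into_space[OF E] .
  have "flip {n} -` (I 1 \<inter> E) \<inter> space ?N = I (-1) \<inter> E"
    using n inv flip_space E_space by (auto simp: I_def flip_apply minus_equation_iff)
  then have "measure ?N (I (-1) \<inter> E) = measure ?N (I 1 \<inter> E)"
    using emeasure_flip_vimage[of "I 1 \<inter> E" "{n}"] I E by (simp add: measure_def)
  moreover have "measure ?N E = measure ?N (I (-1) \<inter> E) + measure ?N (I 1 \<inter> E)"
  proof -
    have "x n * x (n - 1) = -1 \<or> x n * x (n - 1) = 1" if "x \<in> space ?N" for x
      using sign_cases[OF that, of n] sign_cases[OF that, of "n - 1"] n by auto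
    then have "E = (I (-1) \<inter> E) \<union> (I 1 \<inter> E)"
      using E_space by (auto simp: I_def)
    moreover have "(I (-1) \<inter> E) \<inter> (I 1 \<inter> E) = {}" by (auto simp: I_def)
    ultimately show ?thesis using finite_measure_Union I E by (metis sets.Int)
  qed
  ultimately have half: "measure ?N (I s \<inter> E) = measure ?N E / 2" if "s \<in> {-1, 1}" for s
    using that by auto
  have "{x \<in> space ?N. x n * x (n - 1) \<in> A} \<inter> E = (\<Union>s\<in>A. I s \<inter> E)"
    by (auto simp: I_def)
  also have "measure ?N \<dots> = (\<Sum>s\<in>A. measure ?N (I s \<inter> E))"
    using A I E by (intro finite_measure_finite_Union)
      (auto simp: disjoint_family_on_def I_def intro: finite_subset)
  also have "\<dots> = (\<Sum>s\<in>A. measure ?N E / 2)"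
    using A by (intro sum.cong refl half) auto
  finally show ?thesis by simp
qed

definition solution_path :: "(int \<Rightarrow> int) \<Rightarrow> int \<Rightarrow> int \<times> int" where
  "solution_path x = (\<lambda>m. (x m * x (m - 1), x m))"

text \<open>
  The law of \<open>X\<close> is pulled back to the joint paths of \<open>(\<xi>, X)\<close> over \<open>W\<close>,
  where it becomes a genuine probability measure for which the coordinate process still has all the
  distributional properties it had on the full path space.
\<close>

lemma weak_solution_on_tail_selector:
  assumes W: "tail_selector W"
  defines "\<xi> \<equiv> \<lambda>n (\<omega> :: int \<Rightarrow> int \<times> int). fst (\<omega> n)"
    and "X \<equiv> \<lambda>n (\<omega> :: int \<Rightarrow> int \<times> int). snd (\<omega> n)"
  shows "\<exists>M F. weak_solution M F \<xi> X \<and> space M = solution_path ` W"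
proof -
  let ?N = "sign_paths"
  define \<Omega> where "\<Omega> = solution_path ` W"
  define \<phi> where "\<phi> \<omega> = (\<lambda>m. X m \<omega>)" for \<omega>
  interpret N: prob_space ?N by (rule prob_space_sign_paths)
  have W_space: "W \<subseteq> space ?N" using W by (simp add: tail_selector_def)
  have \<phi>_path: "\<phi> (solution_path x) = x" for x
    by (simp add: \<phi>_def X_def solution_path_def)
  have \<phi>: "\<phi> \<in> \<Omega> \<rightarrow> space ?N"
    using W_space by (auto simp: \<Omega>_def \<phi>_path)
  have \<xi>_\<phi>: "\<xi> n \<omega> = \<phi> \<omega> n * \<phi> \<omega> (n - 1)" if "\<omega> \<in> \<Omega>" for n \<omega>
    using that by (auto simp: \<Omega>_def \<xi>_def \<phi>_path) (simp add: solution_path_def)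
  have "emeasure ?N A = 0" if A: "A \<in> sets ?N" "\<phi> -` A \<inter> \<Omega> = {}" for A
  proof (rule tail_selector_full_outer_measure[OF W A(1)])
    show "A \<inter> W = {}" using A(2) \<phi>_path by (force simp: \<Omega>_def)
  qed
  from pullback_measure_exists[OF \<phi> this] obtain M
    where space_M: "space M = \<Omega>" and sets_M: "sets M = sets (vimage_algebra \<Omega> \<phi> ?N)"
      and emeasure_M: "\<And>A. A \<in> sets ?N \<Longrightarrow> emeasure M (\<phi> -` A \<inter> \<Omega>) = emeasure ?N A"
    by blast
  have \<phi>_meas: "\<phi> \<in> measurable M ?N"
    using measurable_vimage_algebra1[OF \<phi>] sets_M by (simp cong: measurable_cong_sets)
  have measure_M: "measure M (\<phi> -` A \<inter> \<Omega>) = measure ?N A" if "A \<in> sets ?N" for A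
    using emeasure_M[OF that] by (simp add: measure_def)
  have "\<phi> -` space ?N \<inter> \<Omega> = \<Omega>" using \<phi> by auto
  then have "emeasure M (space M) = 1"
    using emeasure_M[OF sets.top] by (simp add: space_M N.emeasure_space_1)
  then interpret M: prob_space M by (rule prob_spaceI)
  \<comment> \<open>\<open>F\<close> is the filtration generated by \<open>X\<close>; it also makes \<open>\<xi>\<close> adapted.\<close>
  define past where "past n \<omega> = restrict (\<phi> \<omega>) {..n}" for n :: int and \<omega>
  define P where "P n = PiM {..n} (\<lambda>_. fair_sign)" for n :: int
  define F where "F n = vimage_algebra \<Omega> (past n) (P n)" for n
  have restr: "(\<lambda>x. restrict x {..n}) \<in> measurable ?N (P n)" if "n \<le> 0" for n
    unfolding sign_paths_def P_def using that by (intro measurable_restrict_subset) auto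
  have past_meas: "past n \<in> measurable M (P n)" if "n \<le> 0" for n
    unfolding past_def by (rule measurable_compose[OF \<phi>_meas restr[OF that]])
  have past_space: "past n \<in> \<Omega> \<rightarrow> space (P n)" if "n \<le> 0" for n
    using measurable_space[OF past_meas[OF that]] by (auto simp: space_M)
  have past_F: "past n \<in> measurable (F n) (P n)" if "n \<le> 0" for n
    unfolding F_def by (rule measurable_vimage_algebra1[OF past_space[OF that]])
  have space_F: "space (F n) = \<Omega>" for n by (simp add: F_def)
  have X_meas: "X m \<in> measurable (F n) (count_space {-1, 1})" if "m \<le> n" "n \<le> 0" for m n
  proof -
    have "(\<lambda>s. s m) \<in> measurable (P n) fair_sign"
      unfolding P_def using that by (intro measurable_component_singleton) auto
    then have "(\<lambda>\<omega>. past n \<omega> m) \<in> measurable (F n) fair_sign"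
      by (rule measurable_compose[OF past_F[OF that(2)]])
    then show ?thesis
      using that measurable_cong_sets[OF refl[of "sets (F n)"] sets_fair_sign_count_space]
      by (simp add: past_def \<phi>_def)
  qed
  have \<xi>_sign: "\<xi> n \<omega> \<in> {-1, 1}" if "n \<le> 0" "\<omega> \<in> \<Omega>" for n \<omega>
  proof -
    have "\<phi> \<omega> \<in> space ?N" using \<phi> that by auto
    from sign_cases[OF this, of n] sign_cases[OF this, of "n - 1"] show ?thesis
      using that by (auto simp: \<xi>_\<phi>)
  qed
  have \<xi>_meas: "\<xi> n \<in> measurable (F n) (count_space {-1, 1})" if n: "n \<le> 0" for n
  proof -
    have [measurable]: "X n \<in> measurable (F n) (count_space UNIV)"
        "X (n - 1) \<in> measurable (F n) (count_space UNIV)"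
      using n by (auto intro: measurable_compose[OF X_meas measurable_count_space])
    have "(\<lambda>\<omega>. X n \<omega> * X (n - 1) \<omega>) \<in> measurable (F n) (count_space UNIV)"
      by measurable
    then have "\<xi> n \<in> measurable (F n) (count_space UNIV)"
      by (rule measurable_cong[THEN iffD1, rotated]) (simp add: space_F \<xi>_\<phi> \<phi>_def)
    then show ?thesis
      using \<xi>_sign[OF n] by (auto simp: measurable_def space_F)
  qed
  have sub: "subalgebra M (F n)" if "n \<le> 0" for n
    unfolding subalgebra_def F_def
    using sets_image_in_sets[OF space_M past_meas[OF that]] by (simp add: space_M)
  have \<xi>_vimage: "\<xi> n -` A \<inter> \<Omega> = \<phi> -` {x \<in> space ?N. x n * x (n - 1) \<in> A} \<inter> \<Omega>" for n A
    using \<phi> by (auto simp: \<xi>_\<phi>)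
  have \<xi>_M: "\<xi> n \<in> measurable M (count_space {-1, 1})" if "n \<le> 0" for n
    using measurable_from_subalg[OF sub \<xi>_meas] that by auto
  have "weak_solution M F \<xi> X"
  proof unfold_locales
    show "subalgebra M (F n)" if "n \<le> 0" for n by (rule sub[OF that])
    show "sets (F m) \<subseteq> sets (F n)" if "m \<le> n" "n \<le> 0" for m n
    proof -
      have "(\<lambda>s. restrict s {..m}) \<in> measurable (P n) (P m)"
        unfolding P_def using that by (intro measurable_restrict_subset) auto
      from measurable_compose[OF past_F[OF that(2)] this]
      have "(\<lambda>\<omega>. restrict (past n \<omega>) {..m}) \<in> measurable (F n) (P m)" .
      moreover have "restrict (past n \<omega>) {..m} = past m \<omega>" for \<omega>
        using that by (auto simp: past_def fun_eq_iff)
      ultimately have "past m \<in> measurable (F n) (P m)" by simp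
      then show ?thesis
        unfolding F_def[of m] by (rule sets_image_in_sets[OF space_F])
    qed
    show "\<xi> n \<in> measurable (F n) (count_space {-1, 1})" if "n \<le> 0" for n
      by (rule \<xi>_meas[OF that])
    show "X n \<in> measurable (F n) (count_space {-1, 1})" if "n \<le> 0" for n
      by (rule X_meas[OF order_refl that])
    show "X n \<omega> = X (n - 1) \<omega> * \<xi> n \<omega>" if n: "n \<le> 0" and \<omega>: "\<omega> \<in> space M" for n \<omega>
    proof -
      have "\<phi> \<omega> \<in> space ?N" using \<phi> \<omega> by (auto simp: space_M)
      from sign_cases[OF this, of n] sign_cases[OF this, of "n - 1"] show ?thesis
        using n \<omega> by (auto simp: space_M \<xi>_\<phi> \<phi>_def)
    qed
    show "M.equiprobable_sign (\<xi> n)" if n: "n \<le> 0" for n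
    proof -
      have "measure M (\<xi> n -` {1} \<inter> \<Omega>) = measure ?N {x \<in> space ?N. x n * x (n - 1) \<in> {1}}"
        unfolding \<xi>_vimage by (rule measure_M[OF increment_event[OF n]])
      also have "\<dots> = 1 / 2"
        using increment_conditional_law[OF n, of "{1}" "space ?N"] flip_space
        by (simp add: N.prob_space Int_absorb2)
      also have "\<xi> n -` {1} \<inter> \<Omega> = {\<omega> \<in> space M. \<xi> n \<omega> = 1}" by (auto simp: space_M)
      finally show ?thesis using \<xi>_M[OF n] by (simp add: M.equiprobable_sign_def)
    qed
    show "M.indep_set (sets (vimage_algebra (space M) (\<xi> n) (count_space {-1, 1}))) (sets (F (n - 1)))"
      if n: "n \<le> 0" for n
      unfolding M.indep_sets2_eq
    proof (intro conjI ballI)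
      show "sets (vimage_algebra (space M) (\<xi> n) (count_space {-1, 1})) \<subseteq> sets M"
        by (rule sets_image_in_sets[OF refl \<xi>_M[OF n]])
      show "sets (F (n - 1)) \<subseteq> sets M"
        using sub[of "n - 1"] n by (simp add: subalgebra_def)
      fix a b assume a: "a \<in> sets (vimage_algebra (space M) (\<xi> n) (count_space {-1, 1}))"
        and b: "b \<in> sets (F (n - 1))"
      have "\<xi> n \<in> space M \<rightarrow> space (count_space {-1, 1})"
        using \<xi>_sign[OF n] by (auto simp: space_M)
      from a[unfolded sets_vimage_algebra2[OF this]] obtain A
        where A: "A \<subseteq> {-1, 1}" and a_eq: "a = \<xi> n -` A \<inter> \<Omega>" by (auto simp: space_M)
      from b n obtain B where B: "B \<in> sets (P (n - 1))" and b_eq: "b = past (n - 1) -` B \<inter> \<Omega>"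
        unfolding F_def by (auto simp: sets_vimage_algebra2[OF past_space])
      define I where "I = {x \<in> space ?N. x n * x (n - 1) \<in> A}"
      define E where "E = (\<lambda>x. restrict x {..n - 1}) -` B \<inter> space ?N"
      have I: "I \<in> sets ?N" unfolding I_def by (rule increment_event[OF n])
      have E: "E \<in> sets ?N"
        unfolding E_def using n by (intro measurable_sets[OF restr B]) auto
      have "restrict (flip {n} x) {..n - 1} = restrict x {..n - 1}" for x
        using n by (auto simp: fun_eq_iff flip_apply)
      then have inv: "flip {n} x \<in> E \<longleftrightarrow> x \<in> E" if "x \<in> space ?N" for x
        using that flip_space by (simp add: E_def)
      have a': "a = \<phi> -` I \<inter> \<Omega>" unfolding a_eq \<xi>_vimage I_def ..
      have b': "b = \<phi> -` E \<inter> \<Omega>"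
        using \<phi> by (auto simp: b_eq E_def past_def)
      have "measure M (a \<inter> b) = measure ?N (I \<inter> E)"
        using measure_M[of "I \<inter> E"] I E by (simp add: a' b' vimage_Int Int_ac Int_left_absorb)
      also have "\<dots> = real (card A) / 2 * measure ?N E"
        unfolding I_def by (rule increment_conditional_law[OF n A E inv])
      also have "real (card A) / 2 = measure ?N I"
        using increment_conditional_law[OF n A sets.top] flip_space
        by (simp add: I_def N.prob_space Int_absorb2)
      finally show "measure M (a \<inter> b) = measure M a * measure M b"
        unfolding a' b' by (simp add: measure_M I E)
    qed
  qed
  then show ?thesis using space_M unfolding \<Omega>_def by blast
qed

lemma function_of_past_exists:
  assumes range: "\<And>\<omega>. \<omega> \<in> space M \<Longrightarrow> Y \<omega> \<in> {-1, 1}"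
    and determined: "\<And>\<omega> \<omega>'. \<omega> \<in> space M \<Longrightarrow> \<omega>' \<in> space M \<Longrightarrow>
      (\<And>m. m \<le> n \<Longrightarrow> \<xi> m \<omega> = \<xi> m \<omega>') \<Longrightarrow> Y \<omega> = Y \<omega>'"
  shows "\<exists>f. function_of_past M \<xi> n Y f"
proof -
  define past where "past \<omega> = restrict (\<lambda>m. \<xi> m \<omega>) {..n}" for \<omega>
  define f where "f s = (if s \<in> past ` space M then Y (SOME \<omega>. \<omega> \<in> space M \<and> past \<omega> = s) else 1)" for s
  have some: "(SOME \<omega>. \<omega> \<in> space M \<and> past \<omega> = s) \<in> space M \<and>
      past (SOME \<omega>. \<omega> \<in> space M \<and> past \<omega> = s) = s" if "s \<in> past ` space M" for s
    by (rule someI_ex) (use that in auto)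
  have "f s \<in> {-1, 1}" for s
    using some[of s] range by (auto simp: f_def)
  moreover have "Y \<omega> = f (past \<omega>)" if \<omega>: "\<omega> \<in> space M" for \<omega>
  proof -
    define \<omega>' where "\<omega>' = (SOME \<omega>'. \<omega>' \<in> space M \<and> past \<omega>' = past \<omega>)"
    have \<omega>': "\<omega>' \<in> space M" "past \<omega>' = past \<omega>"
      using some[of "past \<omega>"] \<omega> by (auto simp: \<omega>'_def)
    have "\<xi> m \<omega> = \<xi> m \<omega>'" if "m \<le> n" for m
      using fun_cong[OF \<omega>'(2), of m] that by (simp add: past_def)
    then have "Y \<omega> = Y \<omega>'" by (rule determined[OF \<omega> \<omega>'(1)])
    then show ?thesis using \<omega> by (simp add: f_def \<omega>'_def)
  qed
  ultimately show ?thesis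
    unfolding function_of_past_def past_def by blast
qed

theorem theorem3:
  "(\<exists>(M :: (int \<Rightarrow> int \<times> int) measure) F \<xi> X.
      weak_solution M F \<xi> X \<and> (\<forall>n\<le>0. \<exists>f. function_of_past M \<xi> n (X n) f)) \<and>
   (\<forall>(M :: 'a measure) F \<xi> X n f.
      weak_solution M F \<xi> X \<longrightarrow> n \<le> 0 \<longrightarrow> function_of_past M \<xi> n (X n) f \<longrightarrow>
      f \<notin> measurable (PiM {..n} (\<lambda>_. count_space {-1, 1})) (count_space {-1, 1}))"
proof (intro conjI allI impI)
  obtain W where W: "tail_selector W" using tail_selector_exists ..
  define \<xi> where "\<xi> n \<omega> = fst (\<omega> n)" for n and \<omega> :: "int \<Rightarrow> int \<times> int"
  define X where "X n \<omega> = snd (\<omega> n)" for n and \<omega> :: "int \<Rightarrow> int \<times> int"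
  obtain M F where sol: "weak_solution M F \<xi> X" and space: "space M = solution_path ` W"
    using weak_solution_on_tail_selector[OF W] unfolding \<xi>_def X_def by blast
  have "\<exists>f. function_of_past M \<xi> n (X n) f" if n: "n \<le> 0" for n
  proof (rule function_of_past_exists)
    show "X n \<omega> \<in> {-1, 1}" if "\<omega> \<in> space M" for \<omega>
      by (rule weak_solution.X_sign[OF sol n that])
  next
    fix \<omega> \<omega>' assume "\<omega> \<in> space M" "\<omega>' \<in> space M"
      and eq: "\<And>m. m \<le> n \<Longrightarrow> \<xi> m \<omega> = \<xi> m \<omega>'"
    then obtain x y where x: "x \<in> W" "\<omega> = solution_path x" and y: "y \<in> W" "\<omega>' = solution_path y"
      unfolding space by blast
    have "x n = y n"
      using eq x y
      by (intro tail_selector_sign_determined[OF W x(1) y(1) n]) (simp add: \<xi>_def solution_path_def)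
    then show "X n \<omega> = X n \<omega>'" by (simp add: X_def x y solution_path_def)
  qed
  with sol show "\<exists>(M :: (int \<Rightarrow> int \<times> int) measure) F \<xi> X.
      weak_solution M F \<xi> X \<and> (\<forall>n\<le>0. \<exists>f. function_of_past M \<xi> n (X n) f)" by blast
next
  fix M :: "'a measure" and F \<xi> X n f
  assume "weak_solution M F \<xi> X" and n: "n \<le> 0" and f: "function_of_past M \<xi> n (X n) f"
  then interpret weak_solution M F \<xi> X by simp
  show "f \<notin> measurable (PiM {..n} (\<lambda>_. count_space {-1, 1})) (count_space {-1, 1})"
    by (rule function_of_past_not_measurable[OF n f])
qed

end
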